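(* Let $\gamma_0(x)=\sum_{n\ge0}\mathcal{C}_{n,0}x^n=\frac{1-\sqrt{1-4x}}{2x}$ and $\Gamma(x,y)=\sum_{n,m\ge0}\mathcal{C}_{n+m,m}x^ny^m$, as formal power series. Then \[\Gamma(x,y)=\frac{\gamma_0(x)}{1-y\,\gamma_0(x)^2}=\frac{x\left(1-\sqrt{1-4x}\right)}{2x(x+y)-y\left(1-\sqrt{1-4x}\right)},\] the last equality holding in the field of fractions of $\mathbb{Q}[[x,y]]$.
   Context: A path is a finite sequence of points of $\mathbb{Z}^2$ in which each step is $(1,0)$ or $(0,1)$. For integers $0\le m\le n$, $\mathcal{C}_{n,m}$ denotes the number of paths from $(0,-2m)$ to $(n-m,n-m)$ not crossing the line $y=x$, i.e. all of whose points $(p,q)$ satisfy $q\le p$. Here $\sqrt{1-4x}$ is the formal power series with constant term $1$ whose square is $1-4x$. *)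

theory Defs
  imports "HOL-Computational_Algebra.Computational_Algebra"
begin

definition is_path :: "(int \<times> int) list \<Rightarrow> bool" where
  "is_path ps \<longleftrightarrow> ps \<noteq> [] \<and>
     successively (\<lambda>(p, q) v. v = (p + 1, q) \<or> v = (p, q + 1)) ps"

text \<open>Meaningful for \<open>m \<le> n\<close>; the differences are taken in the integers, so nothing is truncated.\<close>

definition paths :: "nat \<Rightarrow> nat \<Rightarrow> (int \<times> int) list set" where
  "paths n m = {ps. is_path ps \<and> hd ps = (0, - 2 * int m)
                  \<and> last ps = (int n - int m, int n - int m)
                  \<and> (\<forall>(p, q) \<in> set ps. q \<le> p)}"

definition num_paths :: "nat \<Rightarrow> nat \<Rightarrow> nat" where
  "num_paths n m = card (paths n m)"

lemma finite_paths: "finite (paths n m)"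
proof -
  have step: "length ps \<le> nat (fst (last ps) + snd (last ps) - fst (hd ps) - snd (hd ps)) + 1 \<and>
      fst (hd ps) + snd (hd ps) \<le> fst (last ps) + snd (last ps) \<and>
      (\<forall>v \<in> set ps. fst (hd ps) \<le> fst v \<and> fst v \<le> fst (last ps) \<and>
                    snd (hd ps) \<le> snd v \<and> snd v \<le> snd (last ps))"
    if "is_path ps" for ps :: "(int \<times> int) list"
    using that
  proof (induction ps rule: induct_list012)
    case (3 u v vs)
    from "3.prems" have "is_path (v # vs)"
      by (auto simp: is_path_def)
    note IH = "3.IH"(2)[OF this]
    from "3.prems" consider "v = (fst u + 1, snd u)" | "v = (fst u, snd u + 1)"
      by (cases u) (auto simp: is_path_def)
    then show ?case
      using IH by cases fastforce+
  qed (auto simp: is_path_def)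
  let ?A = "{0..int n - int m} \<times> {- 2 * int m..int n - int m}"
  let ?N = "nat (2 * (int n - int m) + 2 * int m) + 1"
  have "paths n m \<subseteq> {ps. set ps \<subseteq> ?A \<and> length ps \<le> ?N}"
  proof
    fix ps assume "ps \<in> paths n m"
    then have *: "is_path ps" "hd ps = (0, - 2 * int m)"
      "last ps = (int n - int m, int n - int m)"
      by (auto simp: paths_def)
    show "ps \<in> {ps. set ps \<subseteq> ?A \<and> length ps \<le> ?N}"
      using step[OF *(1)] unfolding *(2,3) by fastforce
  qed
  then show ?thesis
    by (rule finite_subset) (intro finite_lists_length_le finite_cartesian_product finite_atLeastAtMost_int)
qed

definition sqrt_1_4x :: "rat fps" where
  "sqrt_1_4x = (THE s. fps_nth s 0 = 1 \<and> s\<^sup>2 = 1 - 4 * fps_X)"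

lemma ex1_sqrt_1_4x: "\<exists>!s :: rat fps. fps_nth s 0 = 1 \<and> s\<^sup>2 = 1 - 4 * fps_X"
proof (rule ex_ex1I)
  let ?s = "fps_radical (\<lambda>_ _. 1) 2 (1 - 4 * fps_X :: rat fps)"
  have "fps_nth ?s 0 = 1 \<and> ?s\<^sup>2 = 1 - 4 * fps_X"
    using power_radical[of "1 - 4 * fps_X :: rat fps" "\<lambda>_ _. 1" 1]
    by (simp add: numeral_2_eq_2)
  then show "\<exists>s :: rat fps. fps_nth s 0 = 1 \<and> s\<^sup>2 = 1 - 4 * fps_X"
    by blast
next
  fix s t :: "rat fps"
  assume s: "fps_nth s 0 = 1 \<and> s\<^sup>2 = 1 - 4 * fps_X"
    and t: "fps_nth t 0 = 1 \<and> t\<^sup>2 = 1 - 4 * fps_X"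
  have "s = t \<or> s = - t"
    using s t by (simp flip: power2_eq_iff)
  moreover have "s \<noteq> - t"
  proof
    assume "s = - t"
    then have "fps_nth s 0 = - fps_nth t 0"
      by simp
    then show False
      using s t by simp
  qed
  ultimately show "s = t"
    by blast
qed

text \<open>
  The ring of power series in \<open>x\<close> and \<open>y\<close> over the rationals is rendered as \<^typ>\<open>rat fps fps\<close>:
  the outer variable is \<open>y\<close>, the inner one is \<open>x\<close>, so the coefficient of \<open>x\<^sup>n y\<^sup>m\<close> in \<open>F\<close> is
  \<open>fps_nth (fps_nth F m) n\<close>, and a series in \<open>x\<close> alone is embedded by \<^const>\<open>fps_const\<close>.
\<close>

definition ser_x :: "rat fps fps" where
  "ser_x = fps_const fps_X"

definition ser_y :: "rat fps fps" where
  "ser_y = fps_X"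

definition gamma0 :: "rat fps" where
  "gamma0 = Abs_fps (\<lambda>n. of_nat (num_paths n 0))"

definition Gamma :: "rat fps fps" where
  "Gamma = Abs_fps (\<lambda>m. Abs_fps (\<lambda>n. of_nat (num_paths (n + m) m)))"

text \<open>
  Division of power series is total in the library. In the quotients taken below it is genuine
  division: each divisor divides the dividend, and the denominator used in the fraction field
  of \<^typ>\<open>rat fps fps\<close> is nonzero.
\<close>

lemma sqrt_1_4x: "fps_nth sqrt_1_4x 0 = 1" "sqrt_1_4x\<^sup>2 = 1 - 4 * fps_X"
  using theI'[OF ex1_sqrt_1_4x] by (simp_all add: sqrt_1_4x_def)

lemma gamma0_quotient_exact:
  "(1 - sqrt_1_4x) / (2 * fps_X) * (2 * fps_X) = 1 - sqrt_1_4x"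
proof -
  have "fps_X dvd 1 - sqrt_1_4x"
    by (cases "1 - sqrt_1_4x = 0") (auto simp: fps_dvd_iff sqrt_1_4x Suc_le_eq subdegree_eq_0_iff
        simp flip: neq0_conv)
  moreover have "(2 :: rat fps) dvd 1"
    by (simp add: fps_is_unit_iff)
  ultimately have "2 * fps_X dvd 1 - sqrt_1_4x"
    by (metis mult_unit_dvd_iff')
  then show ?thesis
    by simp
qed

lemma Gamma_quotient_exact:
  "F / (1 - ser_y * (fps_const g)\<^sup>2) * (1 - ser_y * (fps_const g)\<^sup>2) = F"
proof -
  let ?D = "1 - ser_y * (fps_const g)\<^sup>2"
  have 0: "fps_nth ?D 0 = 1"
    by (simp add: ser_y_def)
  have "inverse ?D = fps_right_inverse ?D 1"
    unfolding fps_inverse_def 0 by (simp add: fps_lr_inverse_one_one)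
  then have "?D * inverse ?D = 1"
    using fps_right_inverse[of ?D 1] 0 by (simp only: mult_1)
  moreover have "subdegree ?D = 0"
    by (simp only: subdegree_eq_0_iff 0) simp
  ultimately show ?thesis
    by (simp add: fps_divide_def mult.assoc mult.commute)
qed

lemma Gamma_denominator_nonzero:
  "2 * ser_x * (ser_x + ser_y) - ser_y * (1 - fps_const sqrt_1_4x) \<noteq> 0"
proof -
  have "fps_nth (2 * ser_x * (ser_x + ser_y) - ser_y * (1 - fps_const sqrt_1_4x)) 0 = 2 * fps_X\<^sup>2"
    by (simp add: ser_x_def ser_y_def power2_eq_square mult.assoc numeral_fps_const)
  then show ?thesis
    by (metis fps_zero_nth fps_X_neq_zero mult_eq_0_iff power_not_zero zero_neq_numeral)
qed

end

theory Submission
  imports Defs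
begin

text \<open>
  The series \<open>g = (1 - \<surd>(1 - 4x)) / 2x\<close> satisfies \<open>g = 1 + x g\<^sup>2\<close>, hence
  \<open>g\<^bsup>h+1\<^esup> = g\<^sup>h + x g\<^bsup>h+2\<^esup>\<close>. Splitting off the first step of a path, the generating functions of the
  paths that start at distance \<open>h\<close> below the diagonal satisfy the same recurrence, so they
  are \<open>g\<^bsup>h+1\<^esup>\<close>. The paths counted by \<open>\<C>\<^bsub>n+m,m\<^esub>\<close> have \<open>h = 2m\<close>, and summing \<open>y\<^sup>m g\<^bsup>2m+1\<^esup>\<close> over \<open>m\<close> is
  a geometric series.
\<close>

text \<open>Both endpoints are free, so that removing the first step of a path stays within the
  family.\<close>

definition paths_between :: "int \<times> int \<Rightarrow> int \<times> int \<Rightarrow> (int \<times> int) list set" where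
  "paths_between u e = {ps. is_path ps \<and> hd ps = u \<and> last ps = e \<and> (\<forall>(p, q) \<in> set ps. q \<le> p)}"

lemma paths_eq_paths_between:
  "paths n m = paths_between (0, - 2 * int m) (int n - int m, int n - int m)"
  by (simp add: paths_def paths_between_def)

lemma not_is_path_Nil [simp]: "\<not> is_path []"
  by (simp add: is_path_def)

lemma is_path_Cons:
  "is_path (u # ps) \<longleftrightarrow>
     ps = [] \<or> (is_path ps \<and> (hd ps = (fst u + 1, snd u) \<or> hd ps = (fst u, snd u + 1)))"
  by (cases ps) (auto simp: is_path_def split: prod.splits)

lemma is_path_hd_le_last:
  assumes "is_path ps"
  shows "fst (hd ps) \<le> fst (last ps)" "snd (hd ps) \<le> snd (last ps)"
  using assms by (induction ps) (auto simp: is_path_Cons)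

lemma paths_between_empty:
  assumes "fst e < fst u \<or> snd e < snd u \<or> fst u < snd u"
  shows "paths_between u e = {}"
proof -
  have False if "ps \<in> paths_between u e" for ps
  proof -
    from that have ps: "is_path ps" "hd ps = u" "last ps = e" "\<forall>(p, q) \<in> set ps. q \<le> p"
      by (auto simp: paths_between_def)
    then have "u \<in> set ps"
      by (metis hd_in_set not_is_path_Nil)
    with ps have "snd u \<le> fst u"
      by auto
    then show False
      using is_path_hd_le_last[OF ps(1)] ps assms by auto
  qed
  then show ?thesis
    by blast
qed

text \<open>Decomposition by the first step. The hypothesis makes the start admissible: above the
  diagonal the left side is empty, while the right side need not be.\<close>

lemma paths_between_rec:
  assumes "q \<le> p"
  shows "paths_between (p, q) e =
    (if (p, q) = e then {[e]} else {}) \<union>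
    Cons (p, q) ` (paths_between (p + 1, q) e \<union> paths_between (p, q + 1) e)"
    (is "?L = ?R")
proof (rule set_eqI)
  fix ps
  show "ps \<in> ?L \<longleftrightarrow> ps \<in> ?R"
  proof (cases ps)
    case Nil
    then show ?thesis
      by (auto simp: paths_between_def)
  next
    case (Cons u vs)
    then show ?thesis
      using assms
      by (cases "vs = []") (auto simp: paths_between_def is_path_Cons image_iff)
  qed
qed

text \<open>Here \<open>n\<close> is the number of steps right still to be made and \<open>h\<close>
  the depth of the start below the diagonal. A step right turns \<open>(n, h)\<close> into
  \<open>(n - 1, h + 1)\<close>, a step up into \<open>(n, h - 1)\<close>; hence the outer induction
  on \<open>n\<close>, for all \<open>h\<close>, and the inner one on \<open>h\<close>. Finiteness
  is carried along for the cardinality of the union.\<close>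

lemma finite_card_paths_between:
  fixes g :: "rat fps"
  assumes g: "g = 1 + fps_X * g\<^sup>2"
  shows "finite (paths_between (N - int n, N - int n - int h) (N, N)) \<and>
    of_nat (card (paths_between (N - int n, N - int n - int h) (N, N))) = fps_nth (g ^ Suc h) n"
proof -
  have rec: "g ^ Suc h = g ^ h + fps_X * g ^ Suc (Suc h)" for h
  proof -
    have "g ^ Suc h = (1 + fps_X * g\<^sup>2) * g ^ h"
      using g by simp
    then show ?thesis
      by (simp add: algebra_simps power2_eq_square)
  qed
  show ?thesis
  proof (induction n arbitrary: h)
    case 0
    show ?case
    proof (induction h)
      case 0
      have "fps_nth (g ^ Suc 0) 0 = 1"
        by (subst rec) simp
      then show ?case
        by (simp add: paths_between_rec paths_between_empty)
    next
      case (Suc h)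
      \<comment> \<open>In the column of the endpoint a step right overshoots, so the path must go
        up.\<close>
      have "paths_between (N, N - int (Suc h)) (N, N)
          = Cons (N, N - int (Suc h)) ` paths_between (N, N - int h) (N, N)"
        by (subst paths_between_rec) (simp_all add: paths_between_empty)
      moreover have "fps_nth (g ^ Suc (Suc h)) 0 = fps_nth (g ^ Suc h) 0"
        by (subst rec) simp
      ultimately show ?case
        using Suc.IH by (simp add: card_image del: power_Suc)
    qed
  next
    case (Suc n)
    note IH = Suc.IH
    let ?p = "N - int (Suc n)"
    show ?case
    proof (induction h)
      case 0
      \<comment> \<open>From the diagonal a step up would cross it, so the path must go right, to
        depth 1.\<close>
      have "paths_between (?p, ?p) (N, N)
          = Cons (?p, ?p) ` paths_between (N - int n, N - int n - int 1) (N, N)"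
        by (subst paths_between_rec) (simp_all add: paths_between_empty algebra_simps)
      moreover have "fps_nth (g ^ Suc 0) (Suc n) = fps_nth (g ^ Suc 1) n"
        by (subst rec) simp
      ultimately show ?case
        using IH[of 1] by (simp add: card_image del: power_Suc of_nat_Suc)
    next
      case (Suc h)
      \<comment> \<open>The continuations after a step right (\<open>?A\<close>) and after a step up
        (\<open>?B\<close>) are disjoint because their first points differ.\<close>
      let ?A = "paths_between (N - int n, N - int n - int (Suc (Suc h))) (N, N)"
      let ?B = "paths_between (?p, ?p - int h) (N, N)"
      have "paths_between (?p, ?p - int (Suc h)) (N, N) = Cons (?p, ?p - int (Suc h)) ` (?A \<union> ?B)"
        by (subst paths_between_rec) (simp_all add: algebra_simps)
      moreover have "?A \<inter> ?B = {}"
        by (auto simp: paths_between_def)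
      moreover have "fps_nth (g ^ Suc (Suc h)) (Suc n)
          = fps_nth (g ^ Suc (Suc (Suc h))) n + fps_nth (g ^ Suc h) (Suc n)"
        by (subst rec) simp
      ultimately show ?case
        using Suc.IH IH[of "Suc (Suc h)"]
        by (simp add: card_image card_Un_disjoint del: power_Suc of_nat_Suc)
    qed
  qed
qed

text \<open>Taking \<open>N = n\<close> and \<open>h = 2 * m\<close> puts the start at
  \<open>(0, - 2 * m)\<close> and the end at \<open>(n, n)\<close>, as
  \<open>(n + m) - m = n\<close>.\<close>

lemma num_paths_eq_coeff:
  fixes g :: "rat fps"
  assumes "g = 1 + fps_X * g\<^sup>2"
  shows "of_nat (num_paths (n + m) m) = fps_nth (g ^ Suc (2 * m)) n"
  using finite_card_paths_between[OF assms, of "int n" n "2 * m"]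
  by (simp add: num_paths_def paths_eq_paths_between)

text \<open>Squaring \<open>s = 1 - 2 x g\<close> gives \<open>4 x g = 4 x (1 + x g^2)\<close>, and
  \<open>4 x\<close> cancels in the integral domain of power series.\<close>

lemma catalan_functional_equation:
  fixes g s :: "rat fps"
  assumes "g * (2 * fps_X) = 1 - s" "s\<^sup>2 = 1 - 4 * fps_X"
  shows "g = 1 + fps_X * g\<^sup>2"
proof -
  have "s = 1 - g * (2 * fps_X)"
    using assms(1) by (simp add: algebra_simps)
  with assms(2) have "4 * fps_X * g = 4 * fps_X * (1 + fps_X * g\<^sup>2)"
    by (simp add: power2_eq_square algebra_simps)
  then show ?thesis
    by (metis fps_X_neq_zero mult_eq_0_iff mult_left_cancel zero_neq_numeral)
qed

text \<open>The product telescopes. The coefficient ring is general because it will itself be a ring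
  of power series in \<open>x\<close>.\<close>

lemma geometric_fps_mult:
  fixes a b :: "'a :: comm_ring_1"
  shows "Abs_fps (\<lambda>m. a * b ^ m) * (1 - fps_X * fps_const b) = fps_const a"
proof -
  let ?F = "Abs_fps (\<lambda>m. a * b ^ m)"
  have "?F - fps_X * (fps_const b * ?F) = fps_const a"
  proof (rule fps_ext)
    fix m
    show "fps_nth (?F - fps_X * (fps_const b * ?F)) m = fps_nth (fps_const a) m"
      by (cases m) simp_all
  qed
  moreover have "?F * (1 - fps_X * fps_const b) = ?F - fps_X * (fps_const b * ?F)"
    by (simp add: algebra_simps)
  ultimately show ?thesis
    by (simp only:)
qed

theorem theorem6p1:
  shows "gamma0 = (1 - sqrt_1_4x) / (2 * fps_X)
    \<and> Gamma = fps_const gamma0 / (1 - ser_y * (fps_const gamma0)\<^sup>2)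
    \<and> to_fract (fps_const gamma0 / (1 - ser_y * (fps_const gamma0)\<^sup>2))
        = to_fract (ser_x * (1 - fps_const sqrt_1_4x))
          / to_fract (2 * ser_x * (ser_x + ser_y) - ser_y * (1 - fps_const sqrt_1_4x))"
proof -
  define g where "g = (1 - sqrt_1_4x) / (2 * fps_X)"
  have g_mult: "g * (2 * fps_X) = 1 - sqrt_1_4x"
    unfolding g_def by (rule gamma0_quotient_exact)
  have g: "g = 1 + fps_X * g\<^sup>2"
    using g_mult sqrt_1_4x(2) by (rule catalan_functional_equation)
  have gamma0: "gamma0 = g"
    using num_paths_eq_coeff[OF g, of _ 0] by (simp add: gamma0_def fps_eq_iff)
  let ?c = "fps_const g" and ?D = "1 - ser_y * (fps_const g)\<^sup>2"
  let ?E = "2 * ser_x * (ser_x + ser_y) - ser_y * (1 - fps_const sqrt_1_4x)"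
  have D0: "?D \<noteq> 0"
  proof
    assume "?D = 0"
    then have "fps_nth ?D 0 = 0"
      by (simp only: fps_zero_nth)
    then show False
      by (simp add: ser_y_def)
  qed
  have "Gamma = Abs_fps (\<lambda>m. g * (g\<^sup>2) ^ m)"
    using num_paths_eq_coeff[OF g] by (simp add: Gamma_def fps_eq_iff power_mult)
  then have "Gamma * ?D = ?c"
    using geometric_fps_mult[of g "g\<^sup>2"] by (simp add: ser_y_def)
  then have Gamma: "Gamma = ?c / ?D"
    using D0 Gamma_quotient_exact[of ?c g] by (metis mult_right_cancel)
  have c: "?c = 1 + ser_x * ?c\<^sup>2"
    using arg_cong[OF g, of fps_const] by (simp add: ser_x_def flip: fps_const_add fps_const_mult)
  have s: "1 - fps_const sqrt_1_4x = 2 * ser_x * ?c"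
    using arg_cong[OF g_mult, of fps_const]
    by (simp add: ser_x_def numeral_fps_const mult_ac)
  \<comment> \<open>Once \<open>s\<close> is substituted, both sides have the factor
    \<open>2 x c\<close>; what remains is \<open>c = 1 + x c^2\<close> multiplied by
    \<open>y\<close>.\<close>
  have "?c * ?E = ser_x * (1 - fps_const sqrt_1_4x) * ?D"
    unfolding s using c by algebra
  \<comment> \<open>The exact quotient is cleared, and \<open>?D\<close> cancelled, within the power
    series; only then does \<open>to_fract\<close> enter, as a multiplicative map.\<close>
  moreover have "?c / ?D * ?E * ?D = ?c * ?E"
    unfolding mult.assoc mult.commute[of _ ?D]
    unfolding mult.assoc[symmetric] mult.commute[of ?D "?c / ?D"] Gamma_quotient_exact ..
  ultimately have "?c / ?D * ?E * ?D = ser_x * (1 - fps_const sqrt_1_4x) * ?D"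
    by (simp only:)
  then have "?c / ?D * ?E = ser_x * (1 - fps_const sqrt_1_4x)"
    by (simp only: mult_right_cancel[OF D0])
  then have "to_fract (?c / ?D) * to_fract ?E = to_fract (ser_x * (1 - fps_const sqrt_1_4x))"
    by (metis to_fract_mult)
  moreover have "to_fract ?E \<noteq> 0"
    using Gamma_denominator_nonzero by (simp only: to_fract_eq_0_iff not_False_eq_True)
  ultimately have "to_fract (?c / ?D)
      = to_fract (ser_x * (1 - fps_const sqrt_1_4x)) / to_fract ?E"
    by (metis nonzero_eq_divide_eq)
  with Gamma show ?thesis
    unfolding gamma0 by (intro conjI g_def)
qed

end
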